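(* Let $(\Omega,\mathcal F,\mathsf P)$ be a probability space and let $(X_n)_{n\in\mathbb N}$ be a sequence of i.i.d. integrable random variables on it with $\mathsf E_{\mathsf P}[X_1]=0$. Let $S_n:=\sum_{i=1}^n X_i$. Let $\overline\sigma\in(0,\infty)$ and assume that $X_1$ has finite variance $\sigma_{\mathsf P}^2:=\mathrm{Var}_{\mathsf P}[X_1]\le\overline\sigma^2$. Define $$\overline{\mathsf U}^{(2)}_{\mathsf P}(x):=\mathsf E_{\mathsf P}\big[|X_1^2-\sigma_{\mathsf P}^2|\,\mathbf 1\{|X_1^2-\sigma_{\mathsf P}^2|\ge x\}\big],\qquad x\ge 0.$$ Then for any $\varepsilon>0$, $\lambda\in(0,1/2)$, and $m\in\mathbb N\setminus\{1,2\}$, $$\mathsf P\left[\sup_{k\ge m}\frac{|S_k/\overline\sigma|}{c_\varepsilon\sqrt{k\left(\log\log((1+\varepsilon)^2k)+\ell_\varepsilon\right)}}\ge 1\right]\le\frac{2^{1+\varepsilon}\log_{1+\varepsilon}^{-\varepsilon}(2m/3)}{\varepsilon\,\zeta(1+\varepsilon)}+\frac{262}{(\varepsilon^2\overline\sigma^4)\wedge 1}\left(m^{2\lambda-1}+\overline{\mathsf U}^{(2)}_{\mathsf P}(m^\lambda)\right),$$ where $c_\varepsilon:=\big((1+\varepsilon)^{5/4}+(1+\varepsilon)^{3/4}\big)/\sqrt2$, $\ell_\varepsilon:=\log\big(2\zeta(1+\varepsilon)/\log(1+\varepsilon)\big)$, and $\zeta(z):=\sum_{j=1}^\infty j^{-z}$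 for $z>1$ is the Riemann zeta function.
   Context: $\mathbb N=\{1,2,\dots\}$; $a\wedge b=\min(a,b)$; random variables are real-valued. $\log$ is the natural logarithm and $\log_{b}$ the logarithm to base $b$; $\log_{1+\varepsilon}^{-\varepsilon}(x)$ means $(\log_{1+\varepsilon}x)^{-\varepsilon}$. *)

theory Defs
  imports "HOL-Probability.Probability"
begin

(* The Riemann zeta function on the real half-line z > 1, where the series converges;
   for z <= 1 the value is meaningless. *)
definition zeta :: "real \<Rightarrow> real" where
  "zeta z = (\<Sum>j. real (Suc j) powr (- z))"

definition c_eps :: "real \<Rightarrow> real" where
  "c_eps \<epsilon> = ((1 + \<epsilon>) powr (5/4) + (1 + \<epsilon>) powr (3/4)) / sqrt 2"

definition l_eps :: "real \<Rightarrow> real" where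
  "l_eps \<epsilon> = ln (2 * zeta (1 + \<epsilon>) / ln (1 + \<epsilon>))"

definition U2 :: "'a measure \<Rightarrow> ('a \<Rightarrow> real) \<Rightarrow> real \<Rightarrow> real" where
  "U2 M Y x = prob_space.expectation M
     (\<lambda>\<omega>. \<bar>(Y \<omega>)\<^sup>2 - prob_space.variance M Y\<bar> *
          indicator {\<omega> \<in> space M. \<bar>(Y \<omega>)\<^sup>2 - prob_space.variance M Y\<bar> \<ge> x} \<omega>)"

end

theory Submission
  imports Defs "HOL-Real_Asymp.Real_Asymp"
begin

text \<open>
  Three effects make up the bound. Write \<open>S k\<close> for the partial sums and \<open>v\<close> for the variance.

  First, the variables being independent and centred with finite second moment, for every real \<open>l\<close> the process
  \<open>exp (l * S k - l\<^sup>2 / 6 * ((\<Sum>i=1..k. (X i)\<^sup>2) + 2 * k * v))\<close> is a supermartingale, so Ville's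
  inequality bounds the probability that its exponent ever exceeds \<open>x\<close> by \<open>exp (- x)\<close>
  (\<open>self_normalized_maximal_inequality\<close>).

  Second, the random quadratic variation in the exponent can be replaced by a deterministic one. By a
  quantitative strong law for \<open>(X i)\<^sup>2 - v\<close> (\<open>quantitative_strong_law\<close>), obtained from a Hajek--Renyi
  inequality by truncation, the averages of \<open>(X i)\<^sup>2\<close> stay below \<open>v + \<epsilon> * \<sigma>\<^sup>2\<close> at all times from \<open>m\<close> on,
  up to a probability that is the second summand of the bound.

  Third, on this good event the exponent is at least \<open>l * S k\<close> minus a multiple of \<open>k\<close>, and the boundary of the iterated
  logarithm is assembled from such linear boundaries (\<open>stitched_boundary\<close>): time is cut into epochs
  between consecutive powers of \<open>1 + \<epsilon>\<close>, and in the \<open>j\<close>-th epoch the slope is tuned to the middle of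
  the epoch and to a failure probability proportional to \<open>(j + 2) powr (- (1 + \<epsilon>))\<close>. The sum over the
  epochs that meet \<open>{m..}\<close> is a tail of the zeta series, which gives the first summand.
\<close>

section \<open>Maximal inequalities for independent sequences\<close>

text \<open>
  Independence in the form of a conditional expectation: to average over one more coordinate, freeze
  the coordinates already seen and integrate the new one separately. This replaces conditioning on
  the natural filtration.
\<close>
lemma (in prob_space) nn_integral_indep_fresh_coordinate:
  fixes X :: "'i \<Rightarrow> 'a \<Rightarrow> 'b"
  assumes ind: "indep_vars N X I" and J: "J \<subseteq> I" "j \<in> I" "j \<notin> J"
    and h: "h \<in> borel_measurable (PiM (insert j J) N)"
  shows "(\<integral>\<^sup>+\<omega>. h (\<lambda>i\<in>insert j J. X i \<omega>) \<partial>M) =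
         (\<integral>\<^sup>+\<omega>. (\<integral>\<^sup>+\<omega>'. h ((\<lambda>i\<in>J. X i \<omega>)(j := X j \<omega>')) \<partial>M) \<partial>M)"
proof -
  let ?R = "\<lambda>\<omega>. \<lambda>i\<in>J. X i \<omega>"
  have rvX: "random_variable (N i) (X i)" if "i \<in> I" for i
    using ind that by (simp add: indep_vars_def2)
  have rvR: "random_variable (PiM J N) ?R"
    using J rvX by (intro measurable_restrict) auto
  let ?T = "\<lambda>\<omega>. \<lambda>i\<in>{j}. X i \<omega>"
  have rvT: "random_variable (PiM {j} N) ?T"
    using J rvX by (intro measurable_restrict) auto
  have "indep_var (PiM J N) ?R (PiM {j} N) ?T"
    using J by (intro indep_var_restrict[OF ind]) auto
  then have joint: "distr M (PiM J N) ?R \<Otimes>\<^sub>M distr M (PiM {j} N) ?T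
      = distr M (PiM J N \<Otimes>\<^sub>M PiM {j} N) (\<lambda>\<omega>. (?R \<omega>, ?T \<omega>))"
    by (simp add: indep_var_distribution_eq)
  define g where "g p = h ((fst p)(j := snd p j))" for p
  have "(\<lambda>p. (fst p)(j := snd p j)) \<in> measurable (PiM J N \<Otimes>\<^sub>M PiM {j} N) (PiM (insert j J) N)"
  proof (rule measurable_fun_upd[where J=J])
    show "(\<lambda>p. snd p j) \<in> measurable (PiM J N \<Otimes>\<^sub>M PiM {j} N) (N j)"
      by (rule measurable_compose[OF measurable_snd]) (rule measurable_component_singleton, simp)
    show "fst \<in> measurable (PiM J N \<Otimes>\<^sub>M PiM {j} N) (PiM J N)"
      by (rule measurable_fst)
  qed simp
  then have g: "g \<in> borel_measurable (PiM J N \<Otimes>\<^sub>M PiM {j} N)"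
    unfolding g_def[abs_def] using h by (rule measurable_compose)
  interpret T: prob_space "distr M (PiM {j} N) ?T"
    using rvT by (rule prob_space_distr)
  have g': "g \<in> borel_measurable (distr M (PiM J N) ?R \<Otimes>\<^sub>M distr M (PiM {j} N) ?T)"
  proof -
    have "sets (distr M (PiM J N) ?R \<Otimes>\<^sub>M distr M (PiM {j} N) ?T) = sets (PiM J N \<Otimes>\<^sub>M PiM {j} N)"
      by (intro sets_pair_measure_cong) simp_all
    from measurable_cong_sets[OF this refl] g show ?thesis by blast
  qed
  have upd: "(?R \<omega>)(j := X j \<omega>) = (\<lambda>i\<in>insert j J. X i \<omega>)" for \<omega>
    by (auto simp: restrict_def fun_eq_iff)
  have "(\<integral>\<^sup>+\<omega>. h (\<lambda>i\<in>insert j J. X i \<omega>) \<partial>M) = (\<integral>\<^sup>+\<omega>. g (?R \<omega>, ?T \<omega>) \<partial>M)"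
    by (simp only: g_def fst_conv snd_conv restrict_apply' singletonI upd)
  also have "\<dots> = (\<integral>\<^sup>+p. g p \<partial>(distr M (PiM J N) ?R \<Otimes>\<^sub>M distr M (PiM {j} N) ?T))"
    unfolding joint using g rvR rvT by (subst nn_integral_distr) auto
  also have "\<dots> = (\<integral>\<^sup>+f. (\<integral>\<^sup>+t. g (f, t) \<partial>distr M (PiM {j} N) ?T) \<partial>distr M (PiM J N) ?R)"
    using g' by (rule T.nn_integral_fst[symmetric])
  also have "\<dots> = (\<integral>\<^sup>+\<omega>. (\<integral>\<^sup>+t. g (?R \<omega>, t) \<partial>distr M (PiM {j} N) ?T) \<partial>M)"
    using T.borel_measurable_nn_integral_fst[OF g'] by (subst nn_integral_distr[OF rvR]) auto
  also have "\<dots> = (\<integral>\<^sup>+\<omega>. (\<integral>\<^sup>+\<omega>'. g (?R \<omega>, ?T \<omega>') \<partial>M) \<partial>M)"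
  proof (rule nn_integral_cong)
    fix \<omega> assume "\<omega> \<in> space M"
    then have "?R \<omega> \<in> space (PiM J N)" by (rule measurable_space[OF rvR])
    then have "(\<lambda>t. g (?R \<omega>, t)) \<in> borel_measurable (PiM {j} N)"
      by (rule measurable_Pair2[OF g])
    then show "(\<integral>\<^sup>+t. g (?R \<omega>, t) \<partial>distr M (PiM {j} N) ?T) = (\<integral>\<^sup>+\<omega>'. g (?R \<omega>, ?T \<omega>') \<partial>M)"
      by (subst nn_integral_distr[OF rvT]) auto
  qed
  finally show ?thesis by (simp add: g_def)
qed

text \<open>
  Ville's inequality for a nonnegative supermartingale that is given by functions \<^term>\<open>q k\<close> of the
  first \<^term>\<open>k\<close> coordinates. No stopping time is needed: by induction on the horizon \<^term>\<open>j\<close>, the quantity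
  \<open>a * P(level a reached by time j) + E[Q j; level a not reached by time j]\<close> does not exceed
  \<open>E[Q m]\<close>. When the level is first reached at time \<^term>\<open>Suc j\<close>, the value \<open>Q (Suc j)\<close> pays for the
  additional \<^term>\<open>a\<close>; where it has not been reached by time \<^term>\<open>j\<close>, the supermartingale property compares
  \<open>Q (Suc j)\<close> with \<open>Q j\<close>.
\<close>
lemma (in prob_space) supermartingale_maximal_inequality:
  fixes X :: "nat \<Rightarrow> 'a \<Rightarrow> 'b" and q :: "nat \<Rightarrow> (nat \<Rightarrow> 'b) \<Rightarrow> ennreal"
  assumes ind: "indep_vars N X {1..}"
    and meas: "\<And>k. q k \<in> borel_measurable (PiM {1..k} N)"
    and super: "\<And>k f. m \<le> k \<Longrightarrow> k < n \<Longrightarrow> f \<in> space (PiM {1..k} N) \<Longrightarrow>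
        (\<integral>\<^sup>+\<omega>. q (Suc k) (f(Suc k := X (Suc k) \<omega>)) \<partial>M) \<le> q k f"
    and "m \<le> n"
  shows "a * emeasure M {\<omega> \<in> space M. \<exists>k\<in>{m..n}. a \<le> q k (\<lambda>i\<in>{1..k}. X i \<omega>)}
         \<le> (\<integral>\<^sup>+\<omega>. q m (\<lambda>i\<in>{1..m}. X i \<omega>) \<partial>M)"
proof -
  define R where "R k \<omega> = (\<lambda>i\<in>{1..k}. X i \<omega>)" for k \<omega>
  have R[measurable]: "R k \<in> measurable M (PiM {1..k} N)" for k
    unfolding R_def using ind by (intro measurable_restrict) (auto simp: indep_vars_def2)
  define Q where "Q k \<omega> = q k (R k \<omega>)" for k \<omega>
  have Q[measurable]: "Q k \<in> borel_measurable M" for k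
    unfolding Q_def by (rule measurable_compose[OF R meas])
  define H where "H n = {\<omega> \<in> space M. \<exists>k\<in>{m..n}. a \<le> Q k \<omega>}" for n
  have H[measurable]: "H n \<in> sets M" for n unfolding H_def by measurable
  have bound: "j \<le> n \<Longrightarrow> a * emeasure M (H j) + (\<integral>\<^sup>+\<omega>. Q j \<omega> * indicator (space M - H j) \<omega> \<partial>M)
      \<le> (\<integral>\<^sup>+\<omega>. Q m \<omega> \<partial>M)" if "m \<le> j" for j
    using that
  proof (induction j rule: dec_induct)
    case base
    have "a * emeasure M (H m) + (\<integral>\<^sup>+\<omega>. Q m \<omega> * indicator (space M - H m) \<omega> \<partial>M)
        = (\<integral>\<^sup>+\<omega>. a * indicator (H m) \<omega> + Q m \<omega> * indicator (space M - H m) \<omega> \<partial>M)"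
      by (subst nn_integral_add) (auto simp: nn_integral_cmult)
    also have "\<dots> \<le> (\<integral>\<^sup>+\<omega>. Q m \<omega> \<partial>M)"
      by (intro nn_integral_mono) (auto simp: H_def indicator_def)
    finally show ?case .
  next
    case (step k)
    \<comment> \<open>The event that the level has not been reached, as a condition on the path of coordinates.\<close>
    let ?no = "\<lambda>f. \<forall>l\<in>{m..k}. \<not> a \<le> q l (restrict f {1..l})"
    have ql[measurable]: "(\<lambda>f. q l (restrict f {1..l})) \<in> borel_measurable (PiM {1..Suc k} N)"
      if "l \<in> {m..k}" for l
      using that by (intro measurable_compose[OF _ meas] measurable_restrict_subset) auto
    have no_meas: "{f \<in> space (PiM {1..Suc k} N). ?no f} \<in> sets (PiM {1..Suc k} N)"
      by measurable
    define h where "h f = (if ?no f then q (Suc k) f else 0)" for f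
    have ins: "insert (Suc k) {1..k} = {1..Suc k}" by auto
    have hm: "h \<in> borel_measurable (PiM (insert (Suc k) {1..k}) N)"
      unfolding h_def[abs_def] ins
      by (rule measurable_If[OF meas _ no_meas]) simp
    have no_R: "?no (R (Suc k) \<omega>) \<longleftrightarrow> \<omega> \<notin> H k" if "\<omega> \<in> space M" for \<omega>
      using that by (auto simp: R_def H_def Q_def restrict_restrict Int_absorb1)
    \<comment> \<open>Changing the fresh coordinate does not affect what happened up to time \<^term>\<open>k\<close>.\<close>
    have no_upd: "?no ((R k \<omega>)(Suc k := y)) \<longleftrightarrow> \<omega> \<notin> H k" if "\<omega> \<in> space M" for \<omega> y
    proof -
      have "restrict ((R k \<omega>)(Suc k := y)) {1..l} = R l \<omega>" if "l \<le> k" for l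
        using that by (auto simp: R_def restrict_def fun_eq_iff)
      then show ?thesis using \<open>\<omega> \<in> space M\<close> by (auto simp: H_def Q_def)
    qed
    have "a * emeasure M (H (Suc k)) + (\<integral>\<^sup>+\<omega>. Q (Suc k) \<omega> * indicator (space M - H (Suc k)) \<omega> \<partial>M)
        = (\<integral>\<^sup>+\<omega>. a * indicator (H (Suc k)) \<omega> + Q (Suc k) \<omega> * indicator (space M - H (Suc k)) \<omega> \<partial>M)"
      by (subst nn_integral_add) (auto simp: nn_integral_cmult)
    also have "\<dots> \<le> (\<integral>\<^sup>+\<omega>. a * indicator (H k) \<omega> + Q (Suc k) \<omega> * indicator (space M - H k) \<omega> \<partial>M)"
      by (intro nn_integral_mono) (auto simp: H_def indicator_def atLeastAtMostSuc_conv le_Suc_eq)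
    also have "\<dots> = a * emeasure M (H k) + (\<integral>\<^sup>+\<omega>. Q (Suc k) \<omega> * indicator (space M - H k) \<omega> \<partial>M)"
      by (subst nn_integral_add) (auto simp: nn_integral_cmult)
    also have "(\<integral>\<^sup>+\<omega>. Q (Suc k) \<omega> * indicator (space M - H k) \<omega> \<partial>M) = (\<integral>\<^sup>+\<omega>. h (R (Suc k) \<omega>) \<partial>M)"
      using no_R by (intro nn_integral_cong) (auto simp: h_def Q_def indicator_def)
    also have "\<dots> = (\<integral>\<^sup>+\<omega>. (\<integral>\<^sup>+\<omega>'. h ((R k \<omega>)(Suc k := X (Suc k) \<omega>')) \<partial>M) \<partial>M)"
      unfolding R_def ins[symmetric]
      by (rule nn_integral_indep_fresh_coordinate[OF ind _ _ _ hm]) auto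
    also have "\<dots> \<le> (\<integral>\<^sup>+\<omega>. Q k \<omega> * indicator (space M - H k) \<omega> \<partial>M)"
    proof (rule nn_integral_mono)
      fix \<omega> assume \<omega>: "\<omega> \<in> space M"
      have sp: "R k \<omega> \<in> space (PiM {1..k} N)" using measurable_space[OF R \<omega>] .
      show "(\<integral>\<^sup>+\<omega>'. h ((R k \<omega>)(Suc k := X (Suc k) \<omega>')) \<partial>M) \<le> Q k \<omega> * indicator (space M - H k) \<omega>"
        using super[OF step(1) _ sp] \<omega> step.prems
        unfolding h_def no_upd[OF \<omega>] by (cases "\<omega> \<in> H k") (simp_all add: Q_def)
    qed
    finally have "a * emeasure M (H (Suc k)) + (\<integral>\<^sup>+\<omega>. Q (Suc k) \<omega> * indicator (space M - H (Suc k)) \<omega> \<partial>M)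
        \<le> a * emeasure M (H k) + (\<integral>\<^sup>+\<omega>. Q k \<omega> * indicator (space M - H k) \<omega> \<partial>M)"
      by simp
    also have "\<dots> \<le> (\<integral>\<^sup>+\<omega>. Q m \<omega> \<partial>M)"
      using step.prems by (intro step.IH) simp
    finally show ?case .
  qed
  have "a * emeasure M (H n) \<le> a * emeasure M (H n) + (\<integral>\<^sup>+\<omega>. Q n \<omega> * indicator (space M - H n) \<omega> \<partial>M)"
    by simp
  also note bound[OF \<open>m \<le> n\<close> order_refl]
  finally have "a * emeasure M (H n) \<le> (\<integral>\<^sup>+\<omega>. Q m \<omega> \<partial>M)" .
  then show ?thesis by (simp add: H_def Q_def R_def)
qed

lemma (in prob_space) prob_infinite_horizon_le:
  assumes [measurable]: "\<And>k::nat. {\<omega> \<in> space M. P k \<omega>} \<in> sets M"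
    and bnd: "\<And>n. m \<le> n \<Longrightarrow> prob {\<omega> \<in> space M. \<exists>k\<in>{m..n}. P k \<omega>} \<le> b"
  shows "prob {\<omega> \<in> space M. \<exists>k\<in>{m..}. P k \<omega>} \<le> b"
proof -
  let ?A = "\<lambda>n. {\<omega> \<in> space M. \<exists>k\<in>{m..m+n}. P k \<omega>}"
  have "(\<lambda>n. prob (?A n)) \<longlonglongrightarrow> prob (\<Union>n. ?A n)"
  proof (rule finite_Lim_measure_incseq)
    show "range ?A \<subseteq> events" by auto
    show "incseq ?A" by (rule incseq_SucI) auto
  qed
  moreover have "(\<Union>n. ?A n) = {\<omega> \<in> space M. \<exists>k\<in>{m..}. P k \<omega>}"
  proof (intro equalityI subsetI)
    fix \<omega> assume "\<omega> \<in> {\<omega> \<in> space M. \<exists>k\<in>{m..}. P k \<omega>}"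
    then obtain k where k: "\<omega> \<in> space M" "m \<le> k" "P k \<omega>" by auto
    then have "\<omega> \<in> ?A (k - m)" by auto
    then show "\<omega> \<in> (\<Union>n. ?A n)" by (rule UN_I[OF UNIV_I])
  qed fastforce
  ultimately show ?thesis
    using bnd LIMSEQ_le_const2[of "\<lambda>n. prob (?A n)" _ b] by simp
qed

text \<open>
  The process \<open>w k * S k\<^sup>2 + (\<Sum>i\<in>{k<..n}. w i * v i)\<close> is a nonnegative supermartingale: one step
  adds \<open>w (Suc k) * v (Suc k)\<close> to the first summand in the mean, which is just what the second
  summand gives up, and replacing \<open>w (Suc k)\<close> by the larger \<open>w k\<close> only helps. At time \<open>0\<close> it is the
  right-hand side.
\<close>
lemma (in prob_space) Hajek_Renyi_inequality:
  fixes Z :: "nat \<Rightarrow> 'a \<Rightarrow> real"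
  assumes ind: "indep_vars (\<lambda>_. borel) Z {1..}"
    and sq: "\<And>i. 1 \<le> i \<Longrightarrow> integrable M (\<lambda>\<omega>. (Z i \<omega>)\<^sup>2)"
    and mean: "\<And>i. 1 \<le> i \<Longrightarrow> expectation (Z i) = 0"
    and w: "antimono w" "\<And>k. 0 \<le> w k" and "0 \<le> a"
  shows "a * prob {\<omega> \<in> space M. \<exists>k\<in>{0..n}. a \<le> w k * (\<Sum>i=1..k. Z i \<omega>)\<^sup>2}
         \<le> (\<Sum>i=1..n. w i * expectation (\<lambda>\<omega>. (Z i \<omega>)\<^sup>2))"
proof -
  have rv[measurable]: "random_variable borel (Z i)" if "1 \<le> i" for i
    using ind that by (simp add: indep_vars_def2)
  have int: "integrable M (Z i)" if "1 \<le> i" for i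
    using sq[OF that] rv[OF that] by (rule square_integrable_imp_integrable[rotated])
  define v where "v i = expectation (\<lambda>\<omega>. (Z i \<omega>)\<^sup>2)" for i
  have v0: "0 \<le> v i" for i by (simp add: v_def)
  define tail where "tail k = (\<Sum>i\<in>{k<..n}. w i * v i)" for k
  have tail0: "0 \<le> tail k" for k by (simp add: tail_def sum_nonneg v0 w)
  define q where "q k f = ennreal (w k * (\<Sum>i=1..k. f i)\<^sup>2 + tail k)" for k and f :: "nat \<Rightarrow> real"
  have max: "ennreal a * emeasure M {\<omega> \<in> space M. \<exists>k\<in>{0..n}. ennreal a \<le> q k (\<lambda>i\<in>{1..k}. Z i \<omega>)}
         \<le> (\<integral>\<^sup>+\<omega>. q 0 (\<lambda>i\<in>{1..0}. Z i \<omega>) \<partial>M)"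
  proof (rule supermartingale_maximal_inequality[OF ind])
    show "q k \<in> borel_measurable (PiM {1..k} (\<lambda>_. borel))" for k
      unfolding q_def[abs_def] by measurable
  next
    fix k and f :: "nat \<Rightarrow> real" assume "k < n"
    let ?s = "\<Sum>i=1..k. f i"
    have expand: "w (Suc k) * (?s + y)\<^sup>2 + tail (Suc k) =
        (w (Suc k) * ?s\<^sup>2 + tail (Suc k)) + (2 * w (Suc k) * ?s) * y + w (Suc k) * y\<^sup>2" for y
      by (simp add: power2_eq_square algebra_simps)
    have "(\<integral>\<^sup>+\<omega>. q (Suc k) (f(Suc k := Z (Suc k) \<omega>)) \<partial>M)
        = (\<integral>\<^sup>+\<omega>. ennreal (w (Suc k) * (?s + Z (Suc k) \<omega>)\<^sup>2 + tail (Suc k)) \<partial>M)"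
      by (simp add: q_def)
    also have "\<dots> = ennreal (\<integral>\<omega>. w (Suc k) * (?s + Z (Suc k) \<omega>)\<^sup>2 + tail (Suc k) \<partial>M)"
    proof (rule nn_integral_eq_integral)
      show "integrable M (\<lambda>\<omega>. w (Suc k) * (?s + Z (Suc k) \<omega>)\<^sup>2 + tail (Suc k))"
        unfolding expand using int sq by simp
    qed (simp add: w tail0)
    also have "(\<integral>\<omega>. w (Suc k) * (?s + Z (Suc k) \<omega>)\<^sup>2 + tail (Suc k) \<partial>M)
        = w (Suc k) * ?s\<^sup>2 + (w (Suc k) * v (Suc k) + tail (Suc k))"
      unfolding expand using int sq mean by (simp add: prob_space v_def)
    also have "w (Suc k) * v (Suc k) + tail (Suc k) = tail k"
    proof -
      have "{k<..n} = insert (Suc k) {Suc k<..n}" using \<open>k < n\<close> by auto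
      then show ?thesis by (simp add: tail_def)
    qed
    also have "ennreal (w (Suc k) * ?s\<^sup>2 + tail k) \<le> q k f"
      unfolding q_def using antimonoD[OF w(1), of k "Suc k"]
      by (intro ennreal_leI add_right_mono mult_right_mono) auto
    finally show "(\<integral>\<^sup>+\<omega>. q (Suc k) (f(Suc k := Z (Suc k) \<omega>)) \<partial>M) \<le> q k f" .
  qed simp
  let ?A = "{\<omega> \<in> space M. \<exists>k\<in>{0..n}. a \<le> w k * (\<Sum>i=1..k. Z i \<omega>)\<^sup>2 + tail k}"
  have A: "{\<omega> \<in> space M. \<exists>k\<in>{0..n}. ennreal a \<le> q k (\<lambda>i\<in>{1..k}. Z i \<omega>)} = ?A"
    by (auto simp: q_def ennreal_le_iff w tail0 simp del: ennreal_plus)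
  have sets_A: "?A \<in> sets M" by measurable
  have "ennreal (a * prob ?A) \<le> ennreal (tail 0)"
    using max unfolding A
    by (simp add: q_def emeasure_eq_measure ennreal_mult' \<open>0 \<le> a\<close> prob_space)
  then have "a * prob ?A \<le> tail 0"
    by (simp add: ennreal_le_iff tail0)
  moreover have "prob {\<omega> \<in> space M. \<exists>k\<in>{0..n}. a \<le> w k * (\<Sum>i=1..k. Z i \<omega>)\<^sup>2} \<le> prob ?A"
    using sets_A tail0 by (intro finite_measure_mono) (auto intro: order_trans[OF _ le_add_same_cancel1[THEN iffD2]])
  moreover have "{0<..n} = {1..n}" by auto
  ultimately show ?thesis
    using \<open>0 \<le> a\<close> by (auto simp: tail_def v_def intro: order_trans[OF mult_left_mono])
qed

section \<open>A quantitative strong law of large numbers\<close>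

lemma sum_inverse_squares_le:
  assumes "1 \<le> a"
  shows "(\<Sum>i\<in>{a<..n}. 1 / (real i)\<^sup>2) \<le> 1 / real a"
proof (cases "a \<le> n")
  case True
  have "(\<Sum>i\<in>{a<..n}. 1 / (real i)\<^sup>2) \<le> 1 / real a - 1 / real n"
    using True
  proof (induction n rule: dec_induct)
    case (step n)
    have "{a<..Suc n} = insert (Suc n) {a<..n}" using step by auto
    then have "(\<Sum>i\<in>{a<..Suc n}. 1 / (real i)\<^sup>2) \<le> 1 / (real (Suc n))\<^sup>2 + (1 / real a - 1 / real n)"
      using step.IH by simp
    also have "1 / (real (Suc n))\<^sup>2 \<le> 1 / (real n * real (Suc n))"
      unfolding power2_eq_square using step assms by (intro divide_left_mono mult_right_mono) auto
    also have "1 / (real n * real (Suc n)) = 1 / real n - 1 / real (Suc n)"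
      using step assms by (simp add: field_simps)
    finally show ?case by simp
  qed simp
  also have "\<dots> \<le> 1 / real a" by simp
  finally show ?thesis .
qed simp

text \<open>
  If \<^term>\<open>r \<le> m\<close>, the first \<^term>\<open>m\<close> terms are constant and add up to at most \<^term>\<open>1 / m\<close>, and so does the tail
  of the series of inverse squares that follows. Otherwise only such a tail is left, and it starts at \<^term>\<open>r\<close>.
\<close>
lemma sum_truncated_inverse_squares_le:
  fixes r :: real
  assumes m: "1 \<le> m"
  shows "(\<Sum>i=1..n. if r \<le> real (max i m) then 1 / (real (max i m))\<^sup>2 else 0) \<le> 2 / max r (real m)"
proof (cases "r \<le> real m")
  case True
  let ?f = "\<lambda>i. 1 / (real (max i m))\<^sup>2"
  have "(\<Sum>i=1..n. if r \<le> real (max i m) then ?f i else 0) \<le> (\<Sum>i=1..n. ?f i)"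
    by (intro sum_mono) auto
  also have "\<dots> \<le> (\<Sum>i\<in>{1..m} \<union> {m<..n}. ?f i)"
    by (intro sum_mono2) auto
  also have "\<dots> = (\<Sum>i=1..m. ?f i) + (\<Sum>i\<in>{m<..n}. ?f i)"
    by (intro sum.union_disjoint) auto
  also have "(\<Sum>i=1..m. ?f i) = (\<Sum>i=1..m. 1 / (real m)\<^sup>2)"
    by (intro sum.cong) (auto simp: max_def)
  also have "\<dots> = 1 / real m" using m by (simp add: power2_eq_square)
  also have "(\<Sum>i\<in>{m<..n}. ?f i) = (\<Sum>i\<in>{m<..n}. 1 / (real i)\<^sup>2)"
    by (intro sum.cong) (auto simp: max_def)
  also have "\<dots> \<le> 1 / real m" by (rule sum_inverse_squares_le[OF m])
  finally show ?thesis using True by (simp add: max_def)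
next
  case False
  define a where "a = nat \<lceil>r\<rceil> - 1"
  have a: "1 \<le> a" "r \<le> real a + 1" "real a < r"
    using False m unfolding a_def by linarith+
  have "(\<Sum>i=1..n. if r \<le> real (max i m) then 1 / (real (max i m))\<^sup>2 else 0)
      \<le> (\<Sum>i=1..n. if a < i then 1 / (real i)\<^sup>2 else 0)"
  proof (rule sum_mono)
    fix i
    have "r \<le> real (max i m) \<Longrightarrow> a < i \<and> max i m = i"
      using False a by (auto simp: max_def split: if_splits)
    then show "(if r \<le> real (max i m) then 1 / (real (max i m))\<^sup>2 else 0) \<le> (if a < i then 1 / (real i)\<^sup>2 else 0)"
      by auto
  qed
  also have "\<dots> = (\<Sum>i\<in>{a<..n}. 1 / (real i)\<^sup>2)"
    by (rule sum.mono_neutral_cong_right) auto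
  also have "\<dots> \<le> 1 / real a" by (rule sum_inverse_squares_le[OF a(1)])
  also have "\<dots> \<le> 2 / r" using a by (simp add: field_simps)
  finally show ?thesis using False by (simp add: max_def)
qed

text \<open>
  The pointwise bound behind the variance estimate in the strong law. The level \<^term>\<open>x\<close> is a second,
  lower truncation: below it the square is at most \<^term>\<open>x\<^sup>2\<close>, above it one factor \<^term>\<open>\<bar>y\<bar>\<close> is absorbed by the
  reciprocal from the previous lemma.
\<close>
lemma sum_truncated_squares_le:
  fixes y x :: real
  assumes m: "1 \<le> m" and x: "x \<le> real m"
  shows "(\<Sum>i=1..n. 1 / (real (max i m))\<^sup>2 * (if \<bar>y\<bar> \<le> real (max i m) then y else 0)\<^sup>2)
     \<le> 2 * x\<^sup>2 / real m + 2 * (\<bar>y\<bar> * indicator {x..} \<bar>y\<bar>)"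
proof -
  have "(\<Sum>i=1..n. 1 / (real (max i m))\<^sup>2 * (if \<bar>y\<bar> \<le> real (max i m) then y else 0)\<^sup>2)
     = y\<^sup>2 * (\<Sum>i=1..n. if \<bar>y\<bar> \<le> real (max i m) then 1 / (real (max i m))\<^sup>2 else 0)"
    unfolding sum_distrib_left by (intro sum.cong) auto
  also have "\<dots> \<le> y\<^sup>2 * (2 / max \<bar>y\<bar> (real m))"
    by (intro mult_left_mono sum_truncated_inverse_squares_le m) simp
  also have "\<dots> \<le> 2 * x\<^sup>2 / real m + 2 * (\<bar>y\<bar> * indicator {x..} \<bar>y\<bar>)"
  proof (cases "x \<le> \<bar>y\<bar>")
    case True
    have "y\<^sup>2 * (2 / max \<bar>y\<bar> (real m)) = 2 * \<bar>y\<bar> * (\<bar>y\<bar> / max \<bar>y\<bar> (real m))"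
      by (simp add: power2_eq_square flip: abs_mult)
    also have "\<dots> \<le> 2 * \<bar>y\<bar> * 1"
      using m by (intro mult_left_mono) (auto simp: divide_le_eq_1)
    also have "\<dots> \<le> 2 * x\<^sup>2 / real m + 2 * (\<bar>y\<bar> * indicator {x..} \<bar>y\<bar>)"
      using True by simp
    finally show ?thesis .
  next
    case False
    then have "y\<^sup>2 \<le> x\<^sup>2" using abs_le_square_iff[of y x] by linarith
    moreover have "max \<bar>y\<bar> (real m) = real m" using False x by simp
    ultimately show ?thesis using False m by (simp add: divide_right_mono)
  qed
  finally show ?thesis .
qed

lemma (in prob_space) expectation_identically_distributed:
  fixes g :: "real \<Rightarrow> real"
  assumes "random_variable borel Y" "random_variable borel Z" "distr M borel Y = distr M borel Z"
    and "g \<in> borel_measurable borel"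
  shows "integrable M (\<lambda>\<omega>. g (Y \<omega>)) \<longleftrightarrow> integrable M (\<lambda>\<omega>. g (Z \<omega>))"
    and "expectation (\<lambda>\<omega>. g (Y \<omega>)) = expectation (\<lambda>\<omega>. g (Z \<omega>))"
  using assms integrable_distr_eq[of Y M borel g] integrable_distr_eq[of Z M borel g]
    integral_distr[of Y M borel g] integral_distr[of Z M borel g] by auto

text \<open>
  The Hajek--Renyi inequality is applied to the variables \<^term>\<open>Y i\<close> truncated at the level \<^term>\<open>max i m\<close> and
  recentred. Three errors have to be controlled by the uniform integrability modulus \<^term>\<open>U\<close>.
  The probability that some truncation takes effect is at most \<^term>\<open>U\<close>, because the number of levels
  below \<^term>\<open>\<bar>y\<bar>\<close> is at most \<^term>\<open>\<bar>y\<bar>\<close>, and is zero if \<^term>\<open>\<bar>y\<bar> \<le> m\<close>. The recentring shifts each variable by at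
  most \<^term>\<open>U\<close>; this costs half of \<^term>\<open>\<delta>\<close> as long as \<^term>\<open>U < \<delta> / 2\<close>, and otherwise the claimed bound exceeds one.
  The weighted variances add up to at most \<^term>\<open>2 * x\<^sup>2 / m + 2 * U\<close>.
\<close>
lemma (in prob_space) quantitative_strong_law:
  fixes Y :: "nat \<Rightarrow> 'a \<Rightarrow> real"
  assumes ind: "indep_vars (\<lambda>_. borel) Y {1..}"
    and id: "\<And>i. 1 \<le> i \<Longrightarrow> distr M borel (Y i) = distr M borel (Y 1)"
    and int: "integrable M (Y 1)" and mean: "expectation (Y 1) = 0"
    and m: "1 \<le> m" and x: "x \<le> real m" and \<delta>: "0 < \<delta>"
  defines "U \<equiv> expectation (\<lambda>\<omega>. \<bar>Y 1 \<omega>\<bar> * indicator {x..} \<bar>Y 1 \<omega>\<bar>)"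
  shows "prob {\<omega> \<in> space M. \<exists>k\<in>{m..}. \<delta> * real k \<le> \<bar>\<Sum>i=1..k. Y i \<omega>\<bar>}
         \<le> 9 / min (\<delta>\<^sup>2) 1 * (x\<^sup>2 / real m + U)"
proof (rule prob_infinite_horizon_le)
  have rv[measurable]: "random_variable borel (Y i)" if "1 \<le> i" for i
    using ind that by (simp add: indep_vars_def2)
  show "{\<omega> \<in> space M. \<delta> * real k \<le> \<bar>\<Sum>i=1..k. Y i \<omega>\<bar>} \<in> sets M" for k :: nat
    by measurable
  have U_int: "integrable M (\<lambda>\<omega>. \<bar>Y 1 \<omega>\<bar> * indicator {x..} \<bar>Y 1 \<omega>\<bar>)"
    by (rule Bochner_Integration.integrable_bound[OF int]) (use rv[of 1] in \<open>auto simp: indicator_def\<close>)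
  have U0: "0 \<le> U" by (simp add: U_def)
  have D: "0 < min (\<delta>\<^sup>2) 1" using \<delta> by simp
  fix n assume "m \<le> n"
  let ?A = "{\<omega> \<in> space M. \<exists>k\<in>{m..n}. \<delta> * real k \<le> \<bar>\<Sum>i=1..k. Y i \<omega>\<bar>}"
  show "prob ?A \<le> 9 / min (\<delta>\<^sup>2) 1 * (x\<^sup>2 / real m + U)"
  proof (cases "\<delta> / 2 \<le> U")
    case True
    have "min (\<delta>\<^sup>2) 1 \<le> \<delta>"
    proof (cases "\<delta> \<le> 1")
      case True
      then have "\<delta>\<^sup>2 \<le> \<delta>" using \<delta> by (simp add: power2_eq_square mult_left_le)
      then show ?thesis by simp
    qed simp
    then have "min (\<delta>\<^sup>2) 1 \<le> 9 * U" using True U0 by linarith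
    then have "1 \<le> 9 / min (\<delta>\<^sup>2) 1 * U" using D by (simp add: le_divide_eq)
    also have "\<dots> \<le> 9 / min (\<delta>\<^sup>2) 1 * (x\<^sup>2 / real m + U)"
      using D by (intro mult_left_mono) auto
    finally show ?thesis using prob_le_1[of ?A] by linarith
  next
    case False
    define t where "t i y = (if \<bar>y\<bar> \<le> real (max i m) then y else 0)" for i and y :: real
    have t[measurable]: "t i \<in> borel_measurable borel" for i unfolding t_def by measurable
    have tb: "\<bar>t i y\<bar> \<le> real (max i m)" "\<bar>t i y\<bar> \<le> \<bar>y\<bar>" for i y by (auto simp: t_def)
    have t_int: "integrable M (\<lambda>\<omega>. t i (Y j \<omega>))" if "1 \<le> j" for i j
      using rv[OF that] tb by (intro integrable_const_bound[where B="real (max i m)"]) auto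
    have t2_int: "integrable M (\<lambda>\<omega>. (t i (Y j \<omega>))\<^sup>2)" if "1 \<le> j" for i j
      using rv[OF that] power_mono[OF tb(1) abs_ge_zero, of _ _ 2]
      by (intro integrable_const_bound[where B="(real (max i m))\<^sup>2"]) auto
    define b where "b i = expectation (\<lambda>\<omega>. t i (Y 1 \<omega>))" for i
    have b_eq: "expectation (\<lambda>\<omega>. t i (Y i \<omega>)) = b i" if "1 \<le> i" for i
      unfolding b_def using id[OF that] rv that
      by (intro expectation_identically_distributed) auto
    \<comment> \<open>As \<^term>\<open>Y 1\<close> is centred, the bias equals minus the mean of the part cut off.\<close>
    have b_le: "\<bar>b i\<bar> \<le> U" for i
    proof -
      have "\<bar>b i\<bar> = \<bar>expectation (\<lambda>\<omega>. t i (Y 1 \<omega>) - Y 1 \<omega>)\<bar>"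
        using t_int[of 1 i] int mean by (simp add: b_def)
      also have "\<dots> \<le> expectation (\<lambda>\<omega>. \<bar>t i (Y 1 \<omega>) - Y 1 \<omega>\<bar>)"
        by (rule integral_abs_bound)
      also have "\<dots> \<le> U"
        unfolding U_def
        using t_int[of 1 i] int U_int x by (intro integral_mono) (auto simp: t_def indicator_def)
      finally show ?thesis .
    qed
    define Z where "Z i \<omega> = t i (Y i \<omega>) - b i" for i \<omega>
    have Z_ind: "indep_vars (\<lambda>_. borel) Z {1..}"
      unfolding Z_def[abs_def]
      by (rule indep_vars_compose2[OF ind, where Y="\<lambda>i y. t i y - b i"]) measurable
    have Z_sq_expand: "(Z i \<omega>)\<^sup>2 = (t i (Y i \<omega>))\<^sup>2 - 2 * b i * t i (Y i \<omega>) + (b i)\<^sup>2" for i \<omega>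
      by (simp add: Z_def power2_eq_square algebra_simps)
    have Z_sq: "integrable M (\<lambda>\<omega>. (Z i \<omega>)\<^sup>2)" if "1 \<le> i" for i
      unfolding Z_sq_expand using t_int t2_int that by simp
    have Z_mean: "expectation (Z i) = 0" if "1 \<le> i" for i
      unfolding Z_def using t_int[OF that] b_eq[OF that] by (simp add: prob_space)
    have Z_var: "expectation (\<lambda>\<omega>. (Z i \<omega>)\<^sup>2) \<le> expectation (\<lambda>\<omega>. (t i (Y 1 \<omega>))\<^sup>2)" if "1 \<le> i" for i
    proof -
      have "expectation (\<lambda>\<omega>. (Z i \<omega>)\<^sup>2) = expectation (\<lambda>\<omega>. (t i (Y i \<omega>))\<^sup>2) - (b i)\<^sup>2"
        unfolding Z_sq_expand using t_int[OF that, of i] t2_int[OF that, of i] b_eq[OF that]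
        by (simp add: prob_space power2_eq_square)
      also have "expectation (\<lambda>\<omega>. (t i (Y i \<omega>))\<^sup>2) = expectation (\<lambda>\<omega>. (t i (Y 1 \<omega>))\<^sup>2)"
        using id[OF that] rv that
        by (intro expectation_identically_distributed(2)[where g="\<lambda>y. (t i y)\<^sup>2"]) auto
      finally show ?thesis by simp
    qed
    \<comment> \<open>Constant up to time \<^term>\<open>m\<close>, so that the weights are nonincreasing and, for \<^term>\<open>k \<ge> m\<close>, equal \<^term>\<open>1 / k\<^sup>2\<close>.\<close>
    define w where "w i = 1 / (real (max i m))\<^sup>2" for i
    have w: "antimono w" "\<And>i. 0 \<le> w i"
      using m by (auto simp: w_def intro!: antimonoI divide_left_mono power_mono)
    let ?T = "{\<omega> \<in> space M. \<exists>i\<in>{1..n}. real (max i m) < \<bar>Y i \<omega>\<bar>}"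
    let ?B = "{\<omega> \<in> space M. \<exists>k\<in>{0..n}. (\<delta> / 2)\<^sup>2 \<le> w k * (\<Sum>i=1..k. Z i \<omega>)\<^sup>2}"
    have T_meas[measurable]: "?T \<in> sets M" by measurable
    have Z_rv[measurable]: "random_variable borel (Z i)" if "1 \<le> i" for i
      using Z_ind that by (simp add: indep_vars_def2)
    have B_meas[measurable]: "?B \<in> sets M" by measurable
    have sub: "?A \<subseteq> ?T \<union> ?B"
    proof
      fix \<omega> assume "\<omega> \<in> ?A"
      then obtain k where \<omega>: "\<omega> \<in> space M" and k: "m \<le> k" "k \<le> n"
        and big: "\<delta> * real k \<le> \<bar>\<Sum>i=1..k. Y i \<omega>\<bar>" by auto
      show "\<omega> \<in> ?T \<union> ?B"
      proof (cases "\<omega> \<in> ?T")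
        case False
        have "Y i \<omega> = Z i \<omega> + b i" if "i \<in> {1..k}" for i
        proof -
          have "\<not> real (max i m) < \<bar>Y i \<omega>\<bar>" using False \<omega> k that by auto
          then show ?thesis by (simp add: Z_def t_def)
        qed
        then have "(\<Sum>i=1..k. Y i \<omega>) = (\<Sum>i=1..k. Z i \<omega>) + (\<Sum>i=1..k. b i)"
          by (simp add: sum.distrib)
        moreover have "\<bar>\<Sum>i=1..k. b i\<bar> \<le> (\<Sum>i=1..k. \<delta> / 2)"
          using b_le \<open>\<not> \<delta> / 2 \<le> U\<close>
          by (intro order_trans[OF sum_abs] sum_mono) (meson less_imp_le linorder_not_le order_trans)
        ultimately have "\<delta> / 2 * real k \<le> \<bar>\<Sum>i=1..k. Z i \<omega>\<bar>"
          using big by (simp add: field_simps)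
        then have "(\<delta> / 2 * real k)\<^sup>2 \<le> (\<Sum>i=1..k. Z i \<omega>)\<^sup>2"
          using \<delta> by (subst abs_le_square_iff[symmetric]) simp
        then have "(\<delta> / 2)\<^sup>2 \<le> w k * (\<Sum>i=1..k. Z i \<omega>)\<^sup>2"
          using k m by (simp add: w_def max_def field_simps power_mult_distrib)
        then show ?thesis using \<omega> k by auto
      qed simp
    qed
    have "prob ?T \<le> U"
    proof -
      have "?T = (\<Union>i\<in>{1..n}. {\<omega> \<in> space M. real (max i m) < \<bar>Y i \<omega>\<bar>})" by auto
      then have "prob ?T \<le> (\<Sum>i=1..n. prob {\<omega> \<in> space M. real (max i m) < \<bar>Y i \<omega>\<bar>})"
        by (simp only:) (intro finite_measure_subadditive_finite, auto)
      also have "\<dots> = (\<Sum>i=1..n. expectation (\<lambda>\<omega>. indicator {real (max i m)<..} \<bar>Y 1 \<omega>\<bar>))"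
      proof (rule sum.cong)
        fix i assume "i \<in> {1..n}"
        then have i: "1 \<le> i" by simp
        have "prob {\<omega> \<in> space M. real (max i m) < \<bar>Y i \<omega>\<bar>}
            = expectation (indicator {\<omega> \<in> space M. real (max i m) < \<bar>Y i \<omega>\<bar>})"
          using i by simp
        also have "\<dots> = expectation (\<lambda>\<omega>. indicator {real (max i m)<..} \<bar>Y i \<omega>\<bar>)"
          by (intro Bochner_Integration.integral_cong) (auto simp: indicator_def)
        also have "\<dots> = expectation (\<lambda>\<omega>. indicator {real (max i m)<..} \<bar>Y 1 \<omega>\<bar>)"
          using id[OF i] rv i
          by (intro expectation_identically_distributed(2)[where g="\<lambda>y. indicator {real (max i m)<..} \<bar>y\<bar>"]) auto
        finally show "prob {\<omega> \<in> space M. real (max i m) < \<bar>Y i \<omega>\<bar>}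
            = expectation (\<lambda>\<omega>. indicator {real (max i m)<..} \<bar>Y 1 \<omega>\<bar>)" .
      qed simp
      also have "\<dots> = expectation (\<lambda>\<omega>. \<Sum>i=1..n. indicator {real (max i m)<..} \<bar>Y 1 \<omega>\<bar>)"
        using rv[of 1] by (intro Bochner_Integration.integral_sum[symmetric] integrable_const_bound[where B=1]) auto
      also have "\<dots> \<le> U"
        unfolding U_def
      proof (rule integral_mono[OF _ U_int])
        show "integrable M (\<lambda>\<omega>. \<Sum>i=1..n. indicator {real (max i m)<..} \<bar>Y 1 \<omega>\<bar> :: real)"
          using rv[of 1] by (intro Bochner_Integration.integrable_sum integrable_const_bound[where B=1]) auto
        fix \<omega>
        let ?y = "\<bar>Y 1 \<omega>\<bar>"
        show "(\<Sum>i=1..n. indicator {real (max i m)<..} ?y) \<le> ?y * indicator {x..} ?y"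
        proof (cases "real m < ?y")
          case True
          have "(\<Sum>i=1..n. indicator {real (max i m)<..} ?y) \<le> (\<Sum>i=1..n. if i \<le> nat \<lfloor>?y\<rfloor> then 1 else 0 :: real)"
            by (intro sum_mono) (auto simp: indicator_def le_nat_floor)
          also have "\<dots> = (\<Sum>i\<in>{1..n} \<inter> {..nat \<lfloor>?y\<rfloor>}. 1)"
            by (subst sum.inter_restrict) (auto intro: sum.cong)
          also have "\<dots> \<le> (\<Sum>i=1..nat \<lfloor>?y\<rfloor>. 1)" by (intro sum_mono2) auto
          also have "\<dots> \<le> ?y" by (simp add: of_nat_nat)
          finally show ?thesis using True x by (simp add: indicator_def)
        next
          case False
          then have "(\<Sum>i=1..n. indicator {real (max i m)<..} ?y) = (0 :: real)"
            by (intro sum.neutral) (auto simp: indicator_def)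
          then show ?thesis by simp
        qed
      qed
      finally show ?thesis .
    qed
    moreover have "prob ?B \<le> 4 / \<delta>\<^sup>2 * (2 * x\<^sup>2 / real m + 2 * U)"
    proof -
      have "(\<delta> / 2)\<^sup>2 * prob ?B \<le> (\<Sum>i=1..n. w i * expectation (\<lambda>\<omega>. (Z i \<omega>)\<^sup>2))"
        by (rule Hajek_Renyi_inequality[OF Z_ind Z_sq Z_mean w]) auto
      also have "\<dots> \<le> (\<Sum>i=1..n. w i * expectation (\<lambda>\<omega>. (t i (Y 1 \<omega>))\<^sup>2))"
        using Z_var w by (intro sum_mono mult_left_mono) auto
      also have "\<dots> = expectation (\<lambda>\<omega>. \<Sum>i=1..n. w i * (t i (Y 1 \<omega>))\<^sup>2)"
        using t2_int by simp
      also have "\<dots> \<le> expectation (\<lambda>\<omega>. 2 * x\<^sup>2 / real m + 2 * (\<bar>Y 1 \<omega>\<bar> * indicator {x..} \<bar>Y 1 \<omega>\<bar>))"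
      proof (rule integral_mono)
        show "integrable M (\<lambda>\<omega>. \<Sum>i=1..n. w i * (t i (Y 1 \<omega>))\<^sup>2)"
          using t2_int by (intro Bochner_Integration.integrable_sum integrable_mult_right) simp
        show "integrable M (\<lambda>\<omega>. 2 * x\<^sup>2 / real m + 2 * (\<bar>Y 1 \<omega>\<bar> * indicator {x..} \<bar>Y 1 \<omega>\<bar>))"
          using U_int by simp
        show "(\<Sum>i=1..n. w i * (t i (Y 1 \<omega>))\<^sup>2)
            \<le> 2 * x\<^sup>2 / real m + 2 * (\<bar>Y 1 \<omega>\<bar> * indicator {x..} \<bar>Y 1 \<omega>\<bar>)" for \<omega>
          unfolding w_def t_def by (rule sum_truncated_squares_le[OF m x])
      qed
      also have "\<dots> = 2 * x\<^sup>2 / real m + 2 * U"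
        using U_int by (simp add: U_def prob_space)
      finally show ?thesis using \<delta> by (simp add: field_simps power2_eq_square)
    qed
    moreover have "prob ?A \<le> prob ?T + prob ?B"
      using finite_measure_mono[OF sub] measure_Un_le[OF T_meas B_meas] by simp
    moreover have "4 / \<delta>\<^sup>2 * (2 * x\<^sup>2 / real m + 2 * U) = 8 / \<delta>\<^sup>2 * (x\<^sup>2 / real m + U)"
      by (simp add: algebra_simps add_divide_distrib)
    ultimately have "prob ?A \<le> 1 * U + 8 / \<delta>\<^sup>2 * (x\<^sup>2 / real m + U)"
      by linarith
    also have "\<dots> \<le> 1 / min (\<delta>\<^sup>2) 1 * (x\<^sup>2 / real m + U) + 8 / min (\<delta>\<^sup>2) 1 * (x\<^sup>2 / real m + U)"
    proof (rule add_mono)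
      show "1 * U \<le> 1 / min (\<delta>\<^sup>2) 1 * (x\<^sup>2 / real m + U)"
        by (rule mult_mono) (use D U0 in auto)
      show "8 / \<delta>\<^sup>2 * (x\<^sup>2 / real m + U) \<le> 8 / min (\<delta>\<^sup>2) 1 * (x\<^sup>2 / real m + U)"
      proof (rule mult_right_mono)
        show "8 / \<delta>\<^sup>2 \<le> 8 / min (\<delta>\<^sup>2) 1" using \<delta> D by (intro divide_left_mono) auto
      qed (use U0 in simp)
    qed
    also have "\<dots> = 9 / min (\<delta>\<^sup>2) 1 * (x\<^sup>2 / real m + U)"
      by (simp add: algebra_simps add_divide_distrib)
    finally show ?thesis .
  qed
qed

section \<open>A self-normalized exponential inequality\<close>

text \<open>
  The subtracted \<^term>\<open>x\<^sup>2 / 6\<close> makes the left-hand side bounded, so that its expectation exists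
  for every square-integrable variable. The two sides agree at \<open>0\<close>, and the derivative of the
  difference of their logarithms has the sign of \<^term>\<open>x\<close>, because its numerator collapses to a
  multiple of \<^term>\<open>x ^ 3\<close>.
\<close>
lemma exp_diff_square_le:
  fixes x :: real
  shows "exp (x - x\<^sup>2 / 6) \<le> 1 + x + x\<^sup>2 / 3"
proof -
  define D where "D x = 1 + x + x\<^sup>2 / 3" for x :: real
  have D: "D x > 0" for x
  proof -
    have "D x = (x / 2 + 1)\<^sup>2 + x\<^sup>2 / 12" by (simp add: D_def power2_eq_square field_simps)
    moreover have "(x / 2 + 1)\<^sup>2 + x\<^sup>2 / 12 > 0"
      by (cases "x = 0") (auto intro: add_nonneg_pos)
    ultimately show ?thesis by simp
  qed
  define g where "g x = ln (D x) - x + x\<^sup>2 / 6" for x :: real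
  have der: "(g has_real_derivative x ^ 3 / (9 * D x)) (at x)" for x
  proof -
    have "(g has_real_derivative (1 + 2 * x / 3) / D x - 1 + x / 3) (at x)"
      unfolding g_def[abs_def] D_def[abs_def] using D[of x]
      by (auto intro!: derivative_eq_intros simp: D_def)
    moreover have "(1 + 2 * x / 3) / D x - 1 + x / 3 = x ^ 3 / (9 * D x)"
      using D[of x] by (simp add: field_simps) (simp add: D_def power2_eq_square power3_eq_cube field_simps)
    ultimately show ?thesis by simp
  qed
  have "g 0 \<le> g x"
  proof (cases "x \<ge> 0")
    case True
    then show ?thesis
      using der D by (intro DERIV_nonneg_imp_nondecreasing[of 0 x g]) (auto intro!: exI divide_nonneg_pos)
  next
    case False
    then show ?thesis
      using der D by (intro DERIV_nonpos_imp_nonincreasing[of x 0 g])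
        (auto intro!: exI divide_nonpos_pos simp: power3_eq_cube mult_nonpos_nonpos mult_le_0_iff zero_le_mult_iff)
  qed
  then have "x - x\<^sup>2 / 6 \<le> ln (D x)" by (simp add: g_def D_def)
  then show ?thesis using D[of x] by (simp add: ln_ge_iff D_def)
qed

text \<open>
  With only second moments available, the usual exponential of \<^term>\<open>l * S\<close> need not be integrable; the
  compensation by one third of the observed and two thirds of the expected quadratic variation turns
  it into a nonnegative supermartingale. Indeed, the elementary inequality above gives
  \<open>E[exp (l * X - (l * X)\<^sup>2 / 6)] \<le> 1 + l\<^sup>2 * v / 3 \<le> exp (l\<^sup>2 * v / 3)\<close>.
\<close>
lemma (in prob_space) self_normalized_maximal_inequality:
  fixes X :: "nat \<Rightarrow> 'a \<Rightarrow> real"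
  assumes ind: "indep_vars (\<lambda>_. borel) X {1..}"
    and sq: "\<And>i. 1 \<le> i \<Longrightarrow> integrable M (\<lambda>\<omega>. (X i \<omega>)\<^sup>2)"
    and mean: "\<And>i. 1 \<le> i \<Longrightarrow> expectation (X i) = 0"
    and var: "\<And>i. 1 \<le> i \<Longrightarrow> expectation (\<lambda>\<omega>. (X i \<omega>)\<^sup>2) \<le> v"
  shows "prob {\<omega> \<in> space M. \<exists>k\<in>{0..}. x \<le> l * (\<Sum>i=1..k. X i \<omega>)
            - l\<^sup>2 / 6 * ((\<Sum>i=1..k. (X i \<omega>)\<^sup>2) + 2 * real k * v)} \<le> exp (- x)"
proof (rule prob_infinite_horizon_le)
  have rv[measurable]: "random_variable borel (X i)" if "1 \<le> i" for i
    using ind that by (simp add: indep_vars_def2)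
  have int: "integrable M (X i)" if "1 \<le> i" for i
    using sq[OF that] rv[OF that] by (rule square_integrable_imp_integrable[rotated])
  show "{\<omega> \<in> space M. x \<le> l * (\<Sum>i=1..k. X i \<omega>)
            - l\<^sup>2 / 6 * ((\<Sum>i=1..k. (X i \<omega>)\<^sup>2) + 2 * real k * v)} \<in> sets M" for k :: nat
    by measurable
  define e where "e k f = l * (\<Sum>i=1..k. f i) - l\<^sup>2 / 6 * ((\<Sum>i=1..k. (f i)\<^sup>2) + 2 * real k * v)"
    for k :: nat and f :: "nat \<Rightarrow> real"
  define q where "q k f = ennreal (exp (e k f))" for k f
  fix n :: nat
  have "ennreal (exp x) * emeasure M {\<omega> \<in> space M. \<exists>k\<in>{0..n}. ennreal (exp x) \<le> q k (\<lambda>i\<in>{1..k}. X i \<omega>)}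
         \<le> (\<integral>\<^sup>+\<omega>. q 0 (\<lambda>i\<in>{1..0}. X i \<omega>) \<partial>M)"
  proof (rule supermartingale_maximal_inequality[OF ind])
    show "q k \<in> borel_measurable (PiM {1..k} (\<lambda>_. borel))" for k
      unfolding q_def[abs_def] e_def by measurable
  next
    fix k and f :: "nat \<Rightarrow> real"
    let ?Y = "X (Suc k)"
    have poly: "exp (l * y - (l * y)\<^sup>2 / 6) \<le> 1 + l * y + l\<^sup>2 / 3 * y\<^sup>2" for y
      using exp_diff_square_le[of "l * y"] by (simp add: power_mult_distrib)
    have step: "e (Suc k) (f(Suc k := y)) = e k f - l\<^sup>2 * v / 3 + (l * y - (l * y)\<^sup>2 / 6)" for y
      by (simp add: e_def power2_eq_square algebra_simps)
    have "(\<integral>\<^sup>+\<omega>. ennreal (exp (l * ?Y \<omega> - (l * ?Y \<omega>)\<^sup>2 / 6)) \<partial>M)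
        \<le> (\<integral>\<^sup>+\<omega>. ennreal (1 + l * ?Y \<omega> + l\<^sup>2 / 3 * (?Y \<omega>)\<^sup>2) \<partial>M)"
      by (intro nn_integral_mono ennreal_leI poly)
    also have "\<dots> = ennreal (\<integral>\<omega>. 1 + l * ?Y \<omega> + l\<^sup>2 / 3 * (?Y \<omega>)\<^sup>2 \<partial>M)"
    proof (rule nn_integral_eq_integral)
      show "integrable M (\<lambda>\<omega>. 1 + l * ?Y \<omega> + l\<^sup>2 / 3 * (?Y \<omega>)\<^sup>2)" using int sq by simp
      have "0 \<le> 1 + l * y + l\<^sup>2 / 3 * y\<^sup>2" for y
        using poly[of y] exp_ge_zero[of "l * y - (l * y)\<^sup>2 / 6"] by linarith
      then show "AE \<omega> in M. 0 \<le> 1 + l * ?Y \<omega> + l\<^sup>2 / 3 * (?Y \<omega>)\<^sup>2" by simp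
    qed
    also have "(\<integral>\<omega>. 1 + l * ?Y \<omega> + l\<^sup>2 / 3 * (?Y \<omega>)\<^sup>2 \<partial>M)
        = 1 + l\<^sup>2 / 3 * expectation (\<lambda>\<omega>. (?Y \<omega>)\<^sup>2)"
      using int sq mean by (simp add: prob_space)
    also have "\<dots> \<le> 1 + l\<^sup>2 * v / 3"
      using mult_left_mono[OF var[of "Suc k"], of "l\<^sup>2 / 3"] by simp
    also have "\<dots> \<le> exp (l\<^sup>2 * v / 3)" by (rule exp_ge_add_one_self)
    finally have mgf: "(\<integral>\<^sup>+\<omega>. ennreal (exp (l * ?Y \<omega> - (l * ?Y \<omega>)\<^sup>2 / 6)) \<partial>M)
        \<le> ennreal (exp (l\<^sup>2 * v / 3))"
      by (simp add: ennreal_leI)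
    have "(\<integral>\<^sup>+\<omega>. q (Suc k) (f(Suc k := ?Y \<omega>)) \<partial>M)
        = (\<integral>\<^sup>+\<omega>. ennreal (exp (e k f - l\<^sup>2 * v / 3)) * ennreal (exp (l * ?Y \<omega> - (l * ?Y \<omega>)\<^sup>2 / 6)) \<partial>M)"
      by (simp add: q_def step exp_add ennreal_mult')
    also have "\<dots> = ennreal (exp (e k f - l\<^sup>2 * v / 3)) * (\<integral>\<^sup>+\<omega>. ennreal (exp (l * ?Y \<omega> - (l * ?Y \<omega>)\<^sup>2 / 6)) \<partial>M)"
      by (rule nn_integral_cmult) measurable
    also have "\<dots> \<le> ennreal (exp (e k f - l\<^sup>2 * v / 3)) * ennreal (exp (l\<^sup>2 * v / 3))"
      by (rule mult_left_mono[OF mgf]) simp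
    also have "\<dots> = q k f"
      by (simp add: q_def flip: ennreal_mult' exp_add)
    finally show "(\<integral>\<^sup>+\<omega>. q (Suc k) (f(Suc k := ?Y \<omega>)) \<partial>M) \<le> q k f" .
  qed simp
  also have "{\<omega> \<in> space M. \<exists>k\<in>{0..n}. ennreal (exp x) \<le> q k (\<lambda>i\<in>{1..k}. X i \<omega>)}
    = {\<omega> \<in> space M. \<exists>k\<in>{0..n}. x \<le> l * (\<Sum>i=1..k. X i \<omega>)
            - l\<^sup>2 / 6 * ((\<Sum>i=1..k. (X i \<omega>)\<^sup>2) + 2 * real k * v)}" (is "_ = ?A")
    by (simp add: q_def e_def)
  also have "(\<integral>\<^sup>+\<omega>. q 0 (\<lambda>i\<in>{1..0}. X i \<omega>) \<partial>M) = 1"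
    by (simp add: q_def e_def emeasure_space_1)
  finally have "exp x * prob ?A \<le> 1"
    by (simp add: emeasure_eq_measure flip: ennreal_mult')
  then show "prob ?A \<le> exp (- x)"
    by (simp add: exp_minus field_simps)
qed

section \<open>Stitching linear boundaries\<close>

text \<open>
  On an epoch \<open>[K, p ^ 4 * K]\<close>, a boundary that is linear in the variance \<^term>\<open>\<rho> * u\<close> lies below a multiple of the square root
  boundary. With \<^term>\<open>a = sqrt (u / (K * p\<^sup>2))\<close>, which runs through the interval from \<^term>\<open>1 / p\<close> to \<^term>\<open>p\<close>, the claim is
  \<open>0 \<le> (a - 1 / p) * (p - a)\<close>. The slope \<^term>\<open>l\<close> is the optimal one at the geometric midpoint
  \<^term>\<open>K * p\<^sup>2\<close> of the epoch, where the factor \<^term>\<open>sqrt 2\<close>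
  would suffice; \<^term>\<open>(p + 1 / p) / sqrt 2\<close> is what the two ends of the epoch require.
\<close>
lemma stitched_boundary:
  fixes p x \<rho> K u :: real
  assumes "1 \<le> p" "0 \<le> x" "0 < \<rho>" "0 < K" and u: "K \<le> u" "u \<le> p ^ 4 * K"
  defines "l \<equiv> sqrt (2 * x / (\<rho> * (K * p\<^sup>2)))"
  shows "x \<le> l * ((p + 1 / p) / sqrt 2 * sqrt (\<rho> * x * u)) - l\<^sup>2 / 2 * (\<rho> * u)"
proof -
  define a where "a = sqrt (u / (K * p\<^sup>2))"
  have Kp: "0 < K * p\<^sup>2" using assms by simp
  have a2: "a\<^sup>2 = u / (K * p\<^sup>2)" using assms Kp by (simp add: a_def)
  have "a \<le> p"
    unfolding a_def using u assms Kp
    by (intro real_le_lsqrt) (auto simp: field_simps power2_eq_square power4_eq_xxxx)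
  moreover have "1 / p \<le> a"
    unfolding a_def using u assms Kp
    by (intro real_le_rsqrt) (auto simp: field_simps power2_eq_square)
  ultimately have "0 \<le> (a - 1 / p) * (p - a)" by simp
  also have "(a - 1 / p) * (p - a) = (p + 1 / p) * a - a\<^sup>2 - 1"
    using \<open>1 \<le> p\<close> by (simp add: power2_eq_square field_simps)
  finally have key: "1 \<le> (p + 1 / p) * a - a\<^sup>2" by simp
  have "l * (sqrt (\<rho> * x * u) / sqrt 2) = sqrt (x\<^sup>2 * (u / (K * p\<^sup>2)))"
    unfolding l_def real_sqrt_divide[symmetric] real_sqrt_mult[symmetric]
    using assms by (simp add: field_simps power2_eq_square)
  also have "\<dots> = x * a" unfolding real_sqrt_mult a_def using assms by simp
  finally have "(p + 1 / p) * (l * (sqrt (\<rho> * x * u) / sqrt 2)) = (p + 1 / p) * (x * a)" by simp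
  then have 1: "l * ((p + 1 / p) / sqrt 2 * sqrt (\<rho> * x * u)) = x * ((p + 1 / p) * a)"
    by (simp only: times_divide_eq_left times_divide_eq_right mult_ac)
  have 2: "l\<^sup>2 / 2 * (\<rho> * u) = x * a\<^sup>2"
    using assms Kp by (simp add: l_def a2 field_simps)
  have "x * 1 \<le> x * ((p + 1 / p) * a - a\<^sup>2)" using key assms by (intro mult_left_mono)
  then show ?thesis unfolding 1 2 by (simp add: algebra_simps)
qed

text \<open>
  The form in which the previous lemma meets the maximal inequality: \<^term>\<open>s\<close> stands for the absolute value of
  the partial sum at time \<^term>\<open>k\<close>, and \<^term>\<open>V\<close> for three times its variance proxy.
\<close>
lemma self_normalized_crossing:
  fixes p x \<rho> K \<sigma> s V b :: real and k :: nat
  assumes "1 \<le> p" "0 \<le> x" "0 < \<rho>" "0 < K" "K \<le> k" "k \<le> p ^ 4 * K" "0 < \<sigma>"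
    and V: "V \<le> 3 * \<sigma>\<^sup>2 * \<rho> * k"
    and s: "(p + 1 / p) / sqrt 2 * sqrt (\<rho> * x * k) \<le> s / \<sigma>"
  defines "l \<equiv> sqrt (2 * x / (\<rho> * (K * p\<^sup>2))) / \<sigma>"
  shows "x \<le> l * s - l\<^sup>2 / 6 * V"
proof -
  let ?l = "sqrt (2 * x / (\<rho> * (K * p\<^sup>2)))"
  have l0: "0 \<le> ?l" using assms by simp
  have "x \<le> ?l * ((p + 1 / p) / sqrt 2 * sqrt (\<rho> * x * k)) - ?l\<^sup>2 / 2 * (\<rho> * k)"
    using assms by (intro stitched_boundary) auto
  also have "\<dots> \<le> ?l * (s / \<sigma>) - ?l\<^sup>2 / 2 * (V / (3 * \<sigma>\<^sup>2))"
  proof (intro diff_mono mult_left_mono s l0)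
    show "V / (3 * \<sigma>\<^sup>2) \<le> \<rho> * k" using V \<open>0 < \<sigma>\<close> by (simp add: field_simps)
  qed simp
  also have "\<dots> = l * s - l\<^sup>2 / 6 * V"
    using \<open>0 < \<sigma>\<close> by (simp add: l_def power_divide)
  finally show ?thesis .
qed

text \<open>
  The constant is the factor of the stitched boundary for epochs of ratio \<^term>\<open>1 + \<epsilon>\<close>, multiplied by \<^term>\<open>1 + \<epsilon>\<close>: one square root
  of this additional factor pays for the fluctuation of the quadratic variation, the other one for the
  exponent \<^term>\<open>1 + \<epsilon>\<close> that makes the union bound over epochs summable.
\<close>
lemma c_eps_eq:
  assumes "0 < \<epsilon>"
  shows "c_eps \<epsilon> = (1 + \<epsilon>) * (((1 + \<epsilon>) powr (1/4) + 1 / (1 + \<epsilon>) powr (1/4)) / sqrt 2)"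
proof -
  have "(1 + \<epsilon>) powr (5/4) = (1 + \<epsilon>) * (1 + \<epsilon>) powr (1/4)"
    using assms powr_add[of "1 + \<epsilon>" 1 "1/4"] by simp
  moreover have "(1 + \<epsilon>) powr (3/4) = (1 + \<epsilon>) * (1 / (1 + \<epsilon>) powr (1/4))"
    using assms powr_diff[of "1 + \<epsilon>" 1 "1/4"] by simp
  ultimately show ?thesis by (simp add: c_eps_def distrib_left)
qed

section \<open>The iterated logarithm bound\<close>

lemma zeta_ge_1:
  assumes "1 < s"
  shows "1 \<le> zeta s"
proof -
  have "summable (\<lambda>j. real (Suc j) powr (- s))"
    using assms by (subst summable_Suc_iff) (simp add: summable_real_powr_iff)
  from sum_le_suminf[OF this, of "{0}"] show ?thesis by (simp add: zeta_def)
qed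

text \<open>
  The additive constant in the boundary turns the iterated logarithm into the logarithm of the
  reciprocal of the weight \<open>1 / (2 * \<zeta> * (2 + j))\<close> when \<^term>\<open>k\<close> is the \<^term>\<open>j\<close>-th power of \<^term>\<open>1 + \<epsilon>\<close>, which is the
  form in which the union bound over epochs uses it. It also shows that the boundary is
  positive.
\<close>
lemma ln_ln_plus_l_eps:
  assumes "0 < \<epsilon>" "1 \<le> (k :: real)"
  shows "ln (ln ((1 + \<epsilon>)\<^sup>2 * k)) + l_eps \<epsilon> = ln (2 * zeta (1 + \<epsilon>) * (2 + log (1 + \<epsilon>) k))"
proof -
  have z: "1 \<le> zeta (1 + \<epsilon>)" using assms by (intro zeta_ge_1) simp
  have l: "0 < ln (1 + \<epsilon>)" using assms by simp
  have lg: "0 \<le> log (1 + \<epsilon>) k" using assms by simp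
  have "ln ((1 + \<epsilon>)\<^sup>2 * k) = ln (1 + \<epsilon>) * (2 + log (1 + \<epsilon>) k)"
    using assms l by (simp add: ln_mult ln_realpow log_def field_simps)
  then have "ln (ln ((1 + \<epsilon>)\<^sup>2 * k)) = ln (ln (1 + \<epsilon>)) + ln (2 + log (1 + \<epsilon>) k)"
    using l lg by (simp add: ln_mult)
  then show ?thesis
    using z l lg by (simp add: l_eps_def ln_div ln_mult)
qed

text \<open>
  Comparison with the telescoping series of differences of \<open>s powr (- \<epsilon>) / \<epsilon>\<close>, by the mean value
  theorem.
\<close>
lemma suminf_powr_tail_le:
  fixes \<epsilon> a :: real
  assumes "0 < \<epsilon>" "0 < a"
  shows "summable (\<lambda>i. (a + real i + 1) powr (- (1 + \<epsilon>)))"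
    and "(\<Sum>i. (a + real i + 1) powr (- (1 + \<epsilon>))) \<le> a powr (- \<epsilon>) / \<epsilon>"
proof -
  define f where "f i = (a + real i) powr (- \<epsilon>) / \<epsilon>" for i
  have le: "(a + real i + 1) powr (- (1 + \<epsilon>)) \<le> f i - f (Suc i)" for i
  proof -
    let ?t = "a + real i"
    have t: "0 < ?t" using assms by simp
    have der: "((\<lambda>s. - (s powr (- \<epsilon>) / \<epsilon>)) has_real_derivative s powr (- (1 + \<epsilon>))) (at s)"
      if "?t \<le> s" "s \<le> ?t + 1" for s
      using that t assms
      by (auto intro!: derivative_eq_intros simp: powr_diff powr_minus powr_add field_simps)
    obtain s where s: "?t < s" "s < ?t + 1"
      and eq: "- ((?t + 1) powr (- \<epsilon>) / \<epsilon>) - - (?t powr (- \<epsilon>) / \<epsilon>) = (?t + 1 - ?t) * s powr (- (1 + \<epsilon>))"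
      using MVT2[of ?t "?t + 1", OF _ der] by auto
    have "(?t + 1) powr (- (1 + \<epsilon>)) \<le> s powr (- (1 + \<epsilon>))"
      using s t assms by (intro powr_mono2') auto
    have f: "f i = ?t powr (- \<epsilon>) / \<epsilon>" "f (Suc i) = (?t + 1) powr (- \<epsilon>) / \<epsilon>"
      by (simp_all add: f_def add_ac)
    show ?thesis unfolding f using eq \<open>(?t + 1) powr (- (1 + \<epsilon>)) \<le> s powr (- (1 + \<epsilon>))\<close> by simp
  qed
  have "f \<longlonglongrightarrow> 0"
    unfolding f_def using assms by real_asymp
  then have sums: "(\<lambda>i. f i - f (Suc i)) sums (f 0 - 0)"
    by (rule telescope_sums')
  show "summable (\<lambda>i. (a + real i + 1) powr (- (1 + \<epsilon>)))"
    by (rule summable_comparison_test'[OF sums_summable[OF sums], of 0]) (use le in auto)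
  then show "(\<Sum>i. (a + real i + 1) powr (- (1 + \<epsilon>))) \<le> a powr (- \<epsilon>) / \<epsilon>"
    using suminf_le[OF le _ sums_summable[OF sums]] sums_unique[OF sums] by (simp add: f_def)
qed

theorem theorem3p1:
  fixes M :: "'a measure" and X :: "nat \<Rightarrow> 'a \<Rightarrow> real"
    and \<sigma> \<epsilon> lam :: real and m :: nat
  assumes "prob_space M"
    and "prob_space.indep_vars M (\<lambda>_. borel) X {1..}"
    and "\<And>n. n \<ge> 1 \<Longrightarrow> distr M borel (X n) = distr M borel (X 1)"
    and "\<And>n. n \<ge> 1 \<Longrightarrow> integrable M (X n)"
    and "prob_space.expectation M (X 1) = 0"
    and "\<sigma> > 0"
    and "integrable M (\<lambda>\<omega>. (X 1 \<omega> - prob_space.expectation M (X 1))\<^sup>2)"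
    and "prob_space.variance M (X 1) \<le> \<sigma>\<^sup>2"
    and "\<epsilon> > 0" and "0 < lam" and "lam < 1/2" and "m \<ge> 3"
  shows "measure M {\<omega> \<in> space M.
           (SUP k\<in>{m..}. ereal (\<bar>(\<Sum>i=1..k. X i \<omega>) / \<sigma>\<bar> /
              (c_eps \<epsilon> * sqrt (real k * (ln (ln ((1 + \<epsilon>)\<^sup>2 * real k)) + l_eps \<epsilon>))))) \<ge> 1}
         \<le> 2 powr (1 + \<epsilon>) * (log (1 + \<epsilon>) (2 * real m / 3)) powr (- \<epsilon>) / (\<epsilon> * zeta (1 + \<epsilon>))
           + 262 / min (\<epsilon>\<^sup>2 * \<sigma> ^ 4) 1 *
             (real m powr (2 * lam - 1) + U2 M (X 1) (real m powr lam))"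
proof -
  interpret prob_space M by fact
  note ind = assms(2) and id = assms(3) and mean1 = assms(5) and \<sigma> = assms(6) and \<epsilon> = assms(9)
    and m = assms(12)
  have rv[measurable]: "random_variable borel (X i)" if "1 \<le> i" for i
    using ind that by (simp add: indep_vars_def2)
  have mean: "expectation (X i) = 0" if "1 \<le> i" for i
    using expectation_identically_distributed(2)[where g="\<lambda>y. y", OF rv[OF that] rv id[OF that]] mean1 by simp
  define v where "v = variance (X 1)"
  have sq1: "integrable M (\<lambda>\<omega>. (X 1 \<omega>)\<^sup>2)" and v1: "expectation (\<lambda>\<omega>. (X 1 \<omega>)\<^sup>2) = v"
    using assms(7) unfolding v_def mean1 by simp_all
  have sq: "integrable M (\<lambda>\<omega>. (X i \<omega>)\<^sup>2)" and var: "expectation (\<lambda>\<omega>. (X i \<omega>)\<^sup>2) = v" if "1 \<le> i" for i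
    using expectation_identically_distributed[where g="\<lambda>y. y\<^sup>2", OF rv[OF that] rv id[OF that]] sq1 v1 by simp_all
  have v\<sigma>: "v \<le> \<sigma>\<^sup>2" using assms(8) by (simp add: v_def)

  define \<eta> where "\<eta> = 1 + \<epsilon>"
  define p where "p = \<eta> powr (1/4)"
  \<comment> \<open>On the good event, \<^term>\<open>\<rho> * \<sigma>\<^sup>2 * k\<close> bounds the variance proxy at time \<^term>\<open>k\<close>.\<close>
  define \<rho> where "\<rho> = 1 + \<epsilon> / 3"
  \<comment> \<open>The supremum need not be attained. Since \<^term>\<open>\<rho> < \<eta>\<close>, a boundary lowered by the factor \<^term>\<open>\<theta> < 1\<close> still suffices.\<close>
  define \<theta> where "\<theta> = sqrt (\<rho> / \<eta>)"
  define z where "z = zeta \<eta>"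
  have \<eta>: "1 < \<eta>" and \<rho>: "0 < \<rho>" "\<rho> < \<eta>" using \<epsilon> by (simp_all add: \<eta>_def \<rho>_def)
  have \<theta>: "0 < \<theta>" "\<theta> < 1" using \<eta> \<rho> by (simp_all add: \<theta>_def)
  have p: "1 \<le> p" "p ^ 4 = \<eta>" using \<eta> by (simp_all add: p_def ge_one_powr_ge_zero powr_power)
  have z: "1 \<le> z" unfolding z_def using \<eta> by (rule zeta_ge_1)
  \<comment> \<open>Epoch \<^term>\<open>i\<close> consists of the times between the powers \<^term>\<open>J + i\<close> and \<^term>\<open>J + i + 1\<close> of \<^term>\<open>\<eta>\<close>; epoch \<open>0\<close> contains \<^term>\<open>m\<close>.\<close>
  define J where "J = nat \<lfloor>log \<eta> (real m)\<rfloor>"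
  \<comment> \<open>The failure probability \<^term>\<open>exp (- x i)\<close> is of the order \<open>(J + i + 2) powr (- \<eta>)\<close>, hence summable.\<close>
  define x where "x i = \<eta> * ln (2 * z * (real J + 1 + real i + 1))" for i
  have arg1: "1 \<le> 2 * z * (real J + 1 + real i + 1)" for i
    using mult_mono[of 1 "2 * z" 1 "real J + 1 + real i + 1"] z by simp
  have x0: "0 \<le> x i" for i using arg1[of i] \<eta> by (simp add: x_def)
  define l where "l i = sqrt (2 * x i / (\<rho> * (\<eta> ^ (J + i) * p\<^sup>2))) / \<sigma>" for i

  \<comment> \<open>The event that the empirical second moment fails to concentrate, and the event that a fixed linear boundary is crossed.\<close>
  let ?G = "{\<omega> \<in> space M. \<exists>k\<in>{m..}. \<epsilon> * \<sigma>\<^sup>2 * real k \<le> \<bar>\<Sum>i=1..k. (X i \<omega>)\<^sup>2 - v\<bar>}"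
  let ?C = "\<lambda>l x. {\<omega> \<in> space M. \<exists>k\<in>{0..}. x \<le> l * (\<Sum>i=1..k. X i \<omega>)
            - l\<^sup>2 / 6 * ((\<Sum>i=1..k. (X i \<omega>)\<^sup>2) + 2 * real k * v)}"
  let ?E = "{\<omega> \<in> space M.
           (SUP k\<in>{m..}. ereal (\<bar>(\<Sum>i=1..k. X i \<omega>) / \<sigma>\<bar> /
              (c_eps \<epsilon> * sqrt (real k * (ln (ln ((1 + \<epsilon>)\<^sup>2 * real k)) + l_eps \<epsilon>))))) \<ge> 1}"
  have C_meas[measurable]: "?C l x \<in> sets M" for l x by measurable
  have G_meas[measurable]: "?G \<in> sets M" by measurable

  have sub: "?E \<subseteq> ?G \<union> (\<Union>i. ?C (l i) (x i) \<union> ?C (- l i) (x i))"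
  proof
    fix \<omega> assume "\<omega> \<in> ?E"
    then have \<omega>: "\<omega> \<in> space M" and "ereal \<theta> < (SUP k\<in>{m..}. ereal (\<bar>(\<Sum>i=1..k. X i \<omega>) / \<sigma>\<bar> /
              (c_eps \<epsilon> * sqrt (real k * (ln (ln ((1 + \<epsilon>)\<^sup>2 * real k)) + l_eps \<epsilon>)))))"
      using \<theta> by (auto intro: less_le_trans[of "ereal \<theta>" 1])
    then obtain k where k: "m \<le> k" and ratio: "\<theta> < \<bar>(\<Sum>i=1..k. X i \<omega>) / \<sigma>\<bar> /
              (c_eps \<epsilon> * sqrt (real k * (ln (ln ((1 + \<epsilon>)\<^sup>2 * real k)) + l_eps \<epsilon>)))"
      by (auto simp: less_SUP_iff)
    show "\<omega> \<in> ?G \<union> (\<Union>i. ?C (l i) (x i) \<union> ?C (- l i) (x i))"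
    proof (cases "\<omega> \<in> ?G")
      case False
      define S where "S = (\<Sum>i=1..k. X i \<omega>)"
      define V where "V = (\<Sum>i=1..k. (X i \<omega>)\<^sup>2) + 2 * real k * v"
      have k1: "1 \<le> k" using k m by simp
      have log_k: "log \<eta> (real m) \<le> log \<eta> (real k)" "0 \<le> log \<eta> (real m)"
        using \<eta> k m by simp_all
      define i where "i = nat \<lfloor>log \<eta> (real k)\<rfloor> - J"
      have Ji: "J + i = nat \<lfloor>log \<eta> (real k)\<rfloor>"
        using log_k unfolding i_def J_def by (simp add: floor_mono nat_mono)
      have fl: "real (J + i) \<le> log \<eta> (real k)" "log \<eta> (real k) \<le> real (J + i) + 1"
        unfolding Ji using log_k by linarith+
      have K: "\<eta> ^ (J + i) \<le> real k" "real k \<le> p ^ 4 * \<eta> ^ (J + i)"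
      proof -
        have k_eq: "real k = \<eta> powr log \<eta> (real k)" using \<eta> k1 by simp
        have "\<eta> ^ (J + i) = \<eta> powr real (J + i)" using \<eta> by (intro powr_realpow[symmetric]) simp
        also have "\<dots> \<le> \<eta> powr log \<eta> (real k)" using fl \<eta> by (intro powr_mono) auto
        finally show "\<eta> ^ (J + i) \<le> real k" using k_eq by simp
        have "\<eta> powr log \<eta> (real k) \<le> \<eta> powr (real (J + i) + 1)" using fl \<eta> by (intro powr_mono) auto
        also have "\<dots> = p ^ 4 * \<eta> ^ (J + i)" using \<eta> by (simp add: p powr_add powr_realpow power_add)
        finally show "real k \<le> p ^ 4 * \<eta> ^ (J + i)" using k_eq by simp
      qed
      define L where "L = ln (ln ((1 + \<epsilon>)\<^sup>2 * real k)) + l_eps \<epsilon>"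
      have "x i / \<eta> \<le> L"
      proof -
        have "x i / \<eta> = ln (2 * z * (2 + real (J + i)))" using \<eta> by (simp add: x_def add_ac)
        also have "\<dots> \<le> ln (2 * z * (2 + log \<eta> (real k)))"
          using fl z by (subst ln_le_cancel_iff) (auto intro!: mult_left_mono mult_pos_pos)
        also have "\<dots> = L"
          using ln_ln_plus_l_eps[OF \<epsilon>, of "real k"] k1 by (simp add: L_def \<eta>_def z_def)
        finally show ?thesis .
      qed
      then have xL: "x i \<le> \<eta> * L" using \<eta> by (simp add: field_simps)
      have Lpos: "0 < L"
      proof -
        have "1 * 2 \<le> z * (2 + log \<eta> (real k))" using z log_k by (intro mult_mono) auto
        then have "0 < ln (2 * z * (2 + log \<eta> (real k)))" by (intro ln_gt_zero) linarith
        then show ?thesis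
          using ln_ln_plus_l_eps[OF \<epsilon>, of "real k"] k1 by (simp add: L_def \<eta>_def z_def)
      qed
      have c: "c_eps \<epsilon> = \<eta> * ((p + 1 / p) / sqrt 2)"
        using c_eps_eq[OF \<epsilon>] by (simp add: \<eta>_def p_def)
      have cpos: "0 < c_eps \<epsilon>" unfolding c using \<eta> p by (simp add: add_pos_pos)
      have "(p + 1 / p) / sqrt 2 * sqrt (\<rho> * x i * real k)
          \<le> (p + 1 / p) / sqrt 2 * sqrt (\<rho> * (\<eta> * L) * real k)"
        using xL \<rho> p by (intro mult_left_mono real_sqrt_le_mono mult_right_mono) auto
      also have "sqrt (\<rho> * (\<eta> * L) * real k) = sqrt (\<rho> / \<eta>) * (\<eta> * sqrt (real k * L))"
      proof -
        have "\<rho> * (\<eta> * L) * real k = \<rho> / \<eta> * (\<eta>\<^sup>2 * (real k * L))"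
          using \<eta> by (simp add: power2_eq_square)
        then show ?thesis using \<eta> by (simp only: real_sqrt_mult) simp
      qed
      also have "(p + 1 / p) / sqrt 2 * (sqrt (\<rho> / \<eta>) * (\<eta> * sqrt (real k * L)))
          = \<theta> * (c_eps \<epsilon> * sqrt (real k * L))"
        by (simp add: c \<theta>_def)
      also have "\<dots> \<le> \<bar>S / \<sigma>\<bar>"
        using ratio cpos Lpos k1 unfolding S_def[symmetric] L_def[symmetric]
        by (subst (asm) pos_less_divide_eq) auto
      finally have big: "(p + 1 / p) / sqrt 2 * sqrt (\<rho> * x i * real k) \<le> \<bar>S\<bar> / \<sigma>"
        using \<sigma> by (simp add: abs_divide)
      have "k \<in> {m..}" using k by simp
      then have "\<not> \<epsilon> * \<sigma>\<^sup>2 * real k \<le> \<bar>\<Sum>i=1..k. (X i \<omega>)\<^sup>2 - v\<bar>"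
        using False \<omega> by blast
      then have "(\<Sum>i=1..k. (X i \<omega>)\<^sup>2 - v) \<le> \<epsilon> * \<sigma>\<^sup>2 * real k" by linarith
      then have "V \<le> 3 * (real k * v) + \<epsilon> * \<sigma>\<^sup>2 * real k"
        by (simp add: V_def sum_subtractf algebra_simps)
      also have "\<dots> \<le> 3 * (real k * \<sigma>\<^sup>2) + \<epsilon> * \<sigma>\<^sup>2 * real k"
        using v\<sigma> by (intro add_right_mono mult_left_mono) auto
      also have "\<dots> = 3 * \<sigma>\<^sup>2 * \<rho> * real k"
        by (simp add: \<rho>_def algebra_simps)
      finally have V: "V \<le> 3 * \<sigma>\<^sup>2 * \<rho> * real k" .
      \<comment> \<open>Hence the partial sum, or its negative, crosses the linear boundary of its epoch.\<close>
      have cross: "x i \<le> l i * \<bar>S\<bar> - (l i)\<^sup>2 / 6 * V"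
        unfolding l_def using p x0 \<rho> \<eta> K \<sigma> V big by (intro self_normalized_crossing) auto
      have "\<omega> \<in> ?C (l i) (x i) \<union> ?C (- l i) (x i)"
      proof (cases "0 \<le> S")
        case True
        then have "x i \<le> l i * S - (l i)\<^sup>2 / 6 * V" using cross by simp
        then show ?thesis using \<omega> unfolding S_def V_def by blast
      next
        case False
        then have "x i \<le> - l i * S - (- l i)\<^sup>2 / 6 * V" using cross by simp
        then show ?thesis using \<omega> unfolding S_def V_def by blast
      qed
      then show ?thesis by blast
    qed simp
  qed

  have G: "prob ?G \<le> 262 / min (\<epsilon>\<^sup>2 * \<sigma> ^ 4) 1 *
             (real m powr (2 * lam - 1) + U2 M (X 1) (real m powr lam))"
  proof -
    define Y where "Y i \<omega> = (X i \<omega>)\<^sup>2 - v" for i \<omega>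
    have U: "expectation (\<lambda>\<omega>. \<bar>Y 1 \<omega>\<bar> * indicator {real m powr lam..} \<bar>Y 1 \<omega>\<bar>)
        = U2 M (X 1) (real m powr lam)"
      unfolding U2_def v_def[symmetric] Y_def
      by (intro Bochner_Integration.integral_cong) (auto simp: indicator_def)
    have U0: "0 \<le> U2 M (X 1) (real m powr lam)"
      unfolding U[symmetric] by simp
    have "prob {\<omega> \<in> space M. \<exists>k\<in>{m..}. \<epsilon> * \<sigma>\<^sup>2 * real k \<le> \<bar>\<Sum>i=1..k. Y i \<omega>\<bar>}
        \<le> 9 / min ((\<epsilon> * \<sigma>\<^sup>2)\<^sup>2) 1 * ((real m powr lam)\<^sup>2 / real m
            + expectation (\<lambda>\<omega>. \<bar>Y 1 \<omega>\<bar> * indicator {real m powr lam..} \<bar>Y 1 \<omega>\<bar>))"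
    proof (rule quantitative_strong_law)
      show "indep_vars (\<lambda>_. borel) Y {1..}"
        unfolding Y_def[abs_def]
        by (rule indep_vars_compose2[OF ind, where Y="\<lambda>i y. y\<^sup>2 - v"]) measurable
      show "distr M borel (Y i) = distr M borel (Y 1)" if "1 \<le> i" for i
      proof -
        have "distr M borel (Y j) = distr (distr M borel (X j)) borel (\<lambda>y. y\<^sup>2 - v)" if "1 \<le> j" for j
          using rv[OF that] by (subst distr_distr) (auto simp: comp_def Y_def[abs_def])
        then show ?thesis using id[OF that] that by simp
      qed
      show "integrable M (Y 1)" "expectation (Y 1) = 0"
        using sq1 v1 by (simp_all add: Y_def[abs_def] prob_space)
      show "real m powr lam \<le> real m"
        using powr_mono[of lam 1 "real m"] m assms(11) by simp
    qed (use m \<epsilon> \<sigma> in auto)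
    also have "(\<epsilon> * \<sigma>\<^sup>2)\<^sup>2 = \<epsilon>\<^sup>2 * \<sigma> ^ 4" by (simp add: power_mult_distrib)
    also have "(real m powr lam)\<^sup>2 / real m = real m powr (2 * lam - 1)"
      using m by (simp add: powr_diff powr_power mult.commute)
    finally have "prob ?G \<le> 9 / min (\<epsilon>\<^sup>2 * \<sigma> ^ 4) 1 *
        (real m powr (2 * lam - 1) + U2 M (X 1) (real m powr lam))"
      unfolding U by (simp add: Y_def)
    also have "\<dots> \<le> 262 / min (\<epsilon>\<^sup>2 * \<sigma> ^ 4) 1 *
        (real m powr (2 * lam - 1) + U2 M (X 1) (real m powr lam))"
      using U0 \<epsilon> \<sigma> by (intro mult_right_mono divide_right_mono) auto
    finally show ?thesis .
  qed

  have C: "prob (\<Union>i. ?C (l i) (x i) \<union> ?C (- l i) (x i))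
      \<le> 2 powr (1 + \<epsilon>) * (log (1 + \<epsilon>) (2 * real m / 3)) powr (- \<epsilon>) / (\<epsilon> * zeta (1 + \<epsilon>))"
  proof -
    let ?r = "\<lambda>i. (real J + 1 + real i + 1) powr (- (1 + \<epsilon>))"
    have single: "prob (?C (l i) (x i) \<union> ?C (- l i) (x i)) \<le> 1 / z * ?r i" for i
    proof -
      have "prob (?C (l i) (x i) \<union> ?C (- l i) (x i)) \<le> prob (?C (l i) (x i)) + prob (?C (- l i) (x i))"
        by (rule measure_Un_le) measurable
      also have "\<dots> \<le> exp (- x i) + exp (- x i)"
        by (intro add_mono self_normalized_maximal_inequality ind sq mean) (auto simp: var)
      also have "exp (- x i) = (2 * z * (real J + 1 + real i + 1)) powr (- \<eta>)"
        using arg1[of i] z by (simp add: x_def powr_def)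
      also have "\<dots> = (2 * z) powr (- \<eta>) * ?r i"
        using z by (subst powr_mult) (auto simp: \<eta>_def)
      also have "\<dots> + \<dots> = 2 * (2 * z) powr (- \<eta>) * ?r i" by simp
      \<comment> \<open>One factor \<open>1 / (2 * z)\<close> normalises the two-sided series; the remaining \<open>(2 * z) powr (- \<epsilon>)\<close> is at most one.\<close>
      also have "\<dots> \<le> 2 * (2 * z) powr (- 1) * ?r i"
        using z \<eta> by (intro mult_right_mono mult_left_mono powr_mono) auto
      also have "2 * (2 * z) powr (- 1) = 1 / z" using z by (simp add: powr_minus_divide)
      finally show ?thesis .
    qed
    note tail = suminf_powr_tail_le[OF \<epsilon>, of "real J + 1"]
    have summ: "summable (\<lambda>i. 1 / z * ?r i)"
      by (intro summable_mult tail) simp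
    have summ': "summable (\<lambda>i. prob (?C (l i) (x i) \<union> ?C (- l i) (x i)))"
      by (rule summable_comparison_test'[OF summ, of 0]) (use single in auto)
    have "prob (\<Union>i. ?C (l i) (x i) \<union> ?C (- l i) (x i)) \<le> (\<Sum>i. prob (?C (l i) (x i) \<union> ?C (- l i) (x i)))"
      by (intro finite_measure_subadditive_countably summ') auto
    also have "\<dots> \<le> (\<Sum>i. 1 / z * ?r i)"
      by (intro suminf_le single summ summ')
    also have "\<dots> = 1 / z * (\<Sum>i. ?r i)"
      by (intro suminf_mult tail) simp
    also have "\<dots> \<le> 1 / z * ((real J + 1) powr (- \<epsilon>) / \<epsilon>)"
      using z by (intro mult_left_mono tail) auto
    also have "\<dots> \<le> 1 / z * ((log \<eta> (2 * real m / 3)) powr (- \<epsilon>) / \<epsilon>)"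
    proof (intro mult_left_mono divide_right_mono powr_mono2')
      show "0 < log \<eta> (2 * real m / 3)" using \<eta> m by simp
      have "log \<eta> (2 * real m / 3) \<le> log \<eta> (real m)" using \<eta> m by simp
      also have "\<dots> \<le> real J + 1" unfolding J_def by linarith
      finally show "log \<eta> (2 * real m / 3) \<le> real J + 1" .
    qed (use z \<epsilon> in auto)
    also have "\<dots> = 1 * ((log \<eta> (2 * real m / 3)) powr (- \<epsilon>) / (\<epsilon> * z))" by simp
    also have "\<dots> \<le> 2 powr (1 + \<epsilon>) * ((log \<eta> (2 * real m / 3)) powr (- \<epsilon>) / (\<epsilon> * z))"
      using z \<epsilon> by (intro mult_right_mono ge_one_powr_ge_zero) auto
    finally show ?thesis by (simp add: \<eta>_def z_def)
  qed

  have "prob ?E \<le> prob (?G \<union> (\<Union>i. ?C (l i) (x i) \<union> ?C (- l i) (x i)))"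
    by (rule finite_measure_mono[OF sub]) measurable
  also have "\<dots> \<le> prob ?G + prob (\<Union>i. ?C (l i) (x i) \<union> ?C (- l i) (x i))"
    by (rule measure_Un_le) measurable
  finally show ?thesis using G C by linarith
qed

end
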